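(* Let $f\in\mathrm{H}(\mathbb{D})$ and $z_0\in\mathbb{D}$. Define $g\in\mathrm{H}(\mathbb{D})$ by $g(z)=[f([z,-z_0]),f(z_0)]$. Then $g^{(n)}(0)=D_nf(z_0)$ and $f_n(z_0;z_0,\dots,z_0)=\gamma_n$ for $n=1,2,\dots$, where $\{\gamma_n\}$ is the Schur parameter of $g$.
   Context: $\mathbb{D}=\{z\in\mathbb{C}:|z|<1\}$, and $\mathrm{H}(\mathbb{D})$ is the set of holomorphic functions $f$ on $\mathbb{D}$ with $|f|\le 1$. For $z,w\in\mathbb{D}$ put $[z,w]=\dfrac{z-w}{1-\overline{w}z}$, and put $[z,z]=0$ for $z\in\partial\mathbb{D}$. For $f\in\mathrm{H}(\mathbb{D})$ and $z_0\in\mathbb{D}$ define $\Delta_{z_0}f\in\mathrm{H}(\mathbb{D})$ by $\Delta_{z_0}f(z)=\dfrac{[f(z),f(z_0)]}{[z,z_0]}$ for $z\neq z_0$ and $\Delta_{z_0}f(z_0)=\dfrac{(1-|z_0|^2)f'(z_0)}{1-|f(z_0)|^2}$ (if $f$ is a unimodular constant, $\Delta_{z_0}f\equiv 0$). It is known from the Schwarz–Pick lemma that $\Delta_{z_0}$ maps $\mathrm{H}(\mathbb{D})$ into itself. For points $z_0,z_1,\dots\in\mathbb{D}$ (not necessarily distinct) define $f_j(z;z_{j-1},\dots,z_0)=(\Delta_{z_{j-1}}\circ\cdots\circ\Delta_{z_0})f(z)$, with $f_0(z)=f(z)$ for $j=0$; in $f_n(z_0;z_0,\dots,z_0)$ all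 $n$ base points and the argument equal $z_0$. Peschl's invariant derivatives $D_nf(z_0)$, $n\ge1$, are defined by the expansion $$[f([z,-z_0]),f(z_0)]=\frac{f\left(\frac{z+z_0}{1+\bar z_0z}\right)-f(z_0)}{1-\overline{f(z_0)}f\left(\frac{z+z_0}{1+\bar z_0z}\right)}=\sum_{n=1}^\infty\frac{D_nf(z_0)}{n!}z^n,\qquad z\in\mathbb{D}.$$ Schur algorithm: for $g\in\mathrm{H}(\mathbb{D})$, set $g_0=g$ and inductively $g_{j+1}(z)=\dfrac1z\cdot\dfrac{g_j(z)-\gamma_j}{1-\overline{\gamma_j}g_j(z)}=\dfrac{[g_j(z),\gamma_j]}{[z,0]}$ with $\gamma_j=g_j(0)$ (extended holomorphically to $z=0$; if $g_j$ is a unimodular constant, $g_{j+1}\equiv0$). The sequence $\{\gamma_j\}_{j=0}^\infty$ is the Schur parameter of $g$. *)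

theory Defs
  imports "HOL-Complex_Analysis.Complex_Analysis"
begin

abbreviation unit_disc :: "complex set" where
  "unit_disc \<equiv> ball 0 1"

text \<open>
  Functions on the disc are represented by total functions on the complex numbers whose values
  outside the disc are irrelevant.
\<close>

definition schur_class :: "(complex \<Rightarrow> complex) set" where
  "schur_class = {f. f holomorphic_on unit_disc \<and> (\<forall>z\<in>unit_disc. cmod (f z) \<le> 1)}"

text \<open>
  Since \<open>0 / 0 = 0\<close>, the formula below also yields the convention \<open>[z, z] = 0\<close> for \<open>z\<close> on
  the unit circle.
\<close>

definition pdiff :: "complex \<Rightarrow> complex \<Rightarrow> complex" where
  "pdiff z w = (z - w) / (1 - cnj w * z)"

lemma pdiff_self: "pdiff z z = 0"
  by (simp add: pdiff_def)

definition hyp_quot :: "complex \<Rightarrow> (complex \<Rightarrow> complex) \<Rightarrow> complex \<Rightarrow> complex" where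
  "hyp_quot z0 f z =
     (if z = z0
      then of_real (1 - (cmod z0)\<^sup>2) * deriv f z0 / of_real (1 - (cmod (f z0))\<^sup>2)
      else pdiff (f z) (f z0) / pdiff z z0)"

text \<open>
  The separate convention for unimodular constants needs no case distinction in the definition:
  there \<open>0 / 0 = 0\<close> gives the value \<open>0\<close>.
\<close>

lemma hyp_quot_unimodular:
  assumes "\<And>w. w \<in> unit_disc \<Longrightarrow> f w = c" "cmod c = 1" "z0 \<in> unit_disc" "z \<in> unit_disc"
  shows "hyp_quot z0 f z = 0"
  using assms by (simp add: hyp_quot_def pdiff_self)

text \<open>
  \<open>hyp_divdiff f p j z\<close> is \<open>f\<^sub>j(z; z\<^sub>j\<^sub>-\<^sub>1, \<dots>, z\<^sub>0)\<close> with base points \<open>z\<^sub>i = p i\<close>.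
\<close>

primrec hyp_divdiff ::
    "(complex \<Rightarrow> complex) \<Rightarrow> (nat \<Rightarrow> complex) \<Rightarrow> nat \<Rightarrow> complex \<Rightarrow> complex" where
  "hyp_divdiff f p 0 = f"
| "hyp_divdiff f p (Suc j) = hyp_quot (p j) (hyp_divdiff f p j)"

text \<open>
  The expansion starts at \<open>n = 1\<close>, so it leaves the entry with index \<open>0\<close> open; that entry is
  set to \<open>0\<close> to make the sequence unique.
\<close>

definition peschl_deriv :: "nat \<Rightarrow> (complex \<Rightarrow> complex) \<Rightarrow> complex \<Rightarrow> complex" where
  "peschl_deriv n f z0 =
     (THE D :: nat \<Rightarrow> complex. D 0 = 0 \<and>
        (\<forall>z\<in>unit_disc.
           (\<lambda>k. D (Suc k) / fact (Suc k) * z ^ Suc k) sums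
             pdiff (f (pdiff z (- z0))) (f z0))) n"

text \<open>
  The value at \<open>0\<close> is that of the holomorphic extension, i.e. the limit there. As above, a
  unimodular constant is sent to \<open>0\<close> through \<open>0 / 0 = 0\<close>.
\<close>

definition schur_step :: "(complex \<Rightarrow> complex) \<Rightarrow> complex \<Rightarrow> complex" where
  "schur_step g z =
     (let q = (\<lambda>w. 1 / w * ((g w - g 0) / (1 - cnj (g 0) * g w)))
      in if z = 0 then Lim (at 0) q else q z)"

lemma schur_step_unimodular:
  assumes "\<And>w. w \<in> unit_disc \<Longrightarrow> g w = c" "cmod c = 1" "z \<in> unit_disc"
  shows "schur_step g z = 0"
proof -
  let ?q = "\<lambda>w. 1 / w * ((g w - g 0) / (1 - cnj (g 0) * g w))"
  have q0: "?q w = 0" if "w \<in> unit_disc" for w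
    using assms(1)[OF that] assms(1)[of 0] by simp
  have "eventually (\<lambda>w. w \<in> unit_disc) (at (0::complex))"
    by (intro eventually_at_in_open') auto
  then have "eventually (\<lambda>w. ?q w = 0) (at 0)"
    by (rule eventually_mono) (rule q0)
  then have "(?q \<longlongrightarrow> 0) (at 0)"
    by (rule tendsto_eventually)
  then have "Lim (at 0) ?q = 0"
    by (intro tendsto_Lim) auto
  then show ?thesis
    unfolding schur_step_def Let_def using q0[OF assms(3)] by (simp only: if_cancel)
qed

definition schur_parameter :: "(complex \<Rightarrow> complex) \<Rightarrow> nat \<Rightarrow> complex" where
  "schur_parameter g j = (schur_step ^^ j) g 0"

end

theory Submission
  imports Defs
begin

text \<open>
  Write \<open>\<phi>(z) = [z, -z\<^sub>0]\<close>, the disc automorphism that carries \<open>0\<close> to \<open>z\<^sub>0\<close> and satisfies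
  \<open>[\<phi>(z), z\<^sub>0] = z\<close>. Substituting \<open>\<phi>(z)\<close> into the hyperbolic difference quotient of \<open>h\<close> at
  \<open>z\<^sub>0\<close> therefore turns its denominator into \<open>z\<close>, and what remains is one step of the Schur
  algorithm for \<open>h \<circ> \<phi>\<close> (lemma \<open>hyp_quot_disc_shift\<close>). In other words, \<open>\<phi>\<close> conjugates the
  operator \<open>\<Delta>\<close> based at \<open>z\<^sub>0\<close> to the Schur step, so by induction
  \<open>f\<^sub>n(\<phi>(z); z\<^sub>0, \<dots>, z\<^sub>0)\<close> is the \<open>n\<close>-th Schur iterate of \<open>f \<circ> \<phi>\<close>
  (lemma \<open>hyp_divdiff_disc_shift\<close>); at \<open>z = 0\<close> this gives a Schur parameter of \<open>f \<circ> \<phi>\<close>.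

  The function \<open>g\<close> of the theorem is not \<open>f \<circ> \<phi>\<close> but \<open>[f \<circ> \<phi>, f(z\<^sub>0)]\<close>. It vanishes at \<open>0\<close>, so
  its first Schur iterate is \<open>g(z) / z\<close>, which is also the first Schur iterate of \<open>f \<circ> \<phi>\<close>. From
  index \<open>1\<close> on, the two functions have the same Schur parameter.

  The induction stays in the Schur class by the Schwarz lemma. Unimodular
  constants fit into this: if \<open>|h(a)| = 1\<close> at a point of the disc, then \<open>h\<close> is constant by the
  maximum principle, and \<open>[h, h(a)]\<close> is identically zero, so that in either case \<open>[h, h(a)]\<close> is a
  holomorphic map from the disc to itself that vanishes at \<open>a\<close> (lemma \<open>pdiff_schur_class\<close>).
  The statement on Peschl's derivatives is Taylor's theorem together with the uniqueness of
  power series.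
\<close>

section \<open>Automorphisms of the disc\<close>

lemma pdiff_eq_Moebius: "pdiff z w = Moebius_function 0 w z"
  by (simp add: pdiff_def Moebius_function_simple)

lemma pdiff_in_disc: "z \<in> unit_disc \<Longrightarrow> w \<in> unit_disc \<Longrightarrow> pdiff z w \<in> unit_disc"
  by (simp add: pdiff_eq_Moebius Moebius_function_norm_lt_1)

lemma pdiff_holomorphic: "w \<in> unit_disc \<Longrightarrow> (\<lambda>z. pdiff z w) holomorphic_on unit_disc"
  using Moebius_function_holomorphic[of w 0] by (simp add: pdiff_eq_Moebius[abs_def])

lemma pdiff_inverse:
  assumes "z \<in> unit_disc" "w \<in> unit_disc"
  shows "pdiff (pdiff z (- w)) w = z" and "pdiff (pdiff z w) (- w) = z"
  using assms by (auto simp: pdiff_eq_Moebius Moebius_function_compose)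

lemma pdiff_zero_left: "pdiff 0 (- w) = w"
  by (simp add: pdiff_def)

lemma pdiff_has_derivative_at_base:
  assumes "cmod w < 1"
  shows "((\<lambda>z. pdiff z w) has_field_derivative 1 / of_real (1 - (cmod w)\<^sup>2)) (at w)"
proof -
  have "(cmod w)\<^sup>2 < 1"
    using assms by (simp add: power_less_one_iff)
  then have *: "cnj w * w = of_real ((cmod w)\<^sup>2)" "of_real (1 - (cmod w)\<^sup>2) \<noteq> (0::complex)"
    by (simp_all only: complex_norm_square mult.commute of_real_eq_0_iff)
  then have "1 - cnj w * w \<noteq> 0"
    by simp
  then show ?thesis
    unfolding pdiff_def using *
    by (auto intro!: derivative_eq_intros simp: divide_simps)
qed

lemma pdiff_has_derivative_at_zero:
  "((\<lambda>z. pdiff z (- w)) has_field_derivative of_real (1 - (cmod w)\<^sup>2)) (at 0)"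
  unfolding pdiff_def
  by (auto intro!: derivative_eq_intros simp: complex_norm_square algebra_simps simp del: of_real_power)

section \<open>The Schur class\<close>

lemma schur_class_cong:
  assumes "f \<in> schur_class" "\<And>z. z \<in> unit_disc \<Longrightarrow> f z = g z"
  shows "g \<in> schur_class"
  using assms holomorphic_cong[of unit_disc unit_disc f g] by (auto simp: schur_class_def)

lemma schur_class_compose:
  assumes "f \<in> schur_class" "\<phi> holomorphic_on unit_disc" "\<phi> ` unit_disc \<subseteq> unit_disc"
  shows "(\<lambda>z. f (\<phi> z)) \<in> schur_class"
  using assms holomorphic_on_compose_gen[of \<phi> unit_disc f unit_disc]
  by (force simp: schur_class_def o_def)

lemma schur_class_unimodular_constant:
  assumes f: "f \<in> schur_class" and "a \<in> unit_disc" "z \<in> unit_disc" and "cmod (f a) = 1"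
  shows "f z = f a"
proof -
  have "f constant_on unit_disc"
    using assms
    by (intro maximum_modulus_principle[of f unit_disc unit_disc a]) (auto simp: schur_class_def)
  then show ?thesis
    using assms(2,3) by (auto simp: constant_on_def)
qed

text \<open>
  When \<open>|f(a)| = 1\<close> the denominator of the pseudo-hyperbolic difference vanishes, but then \<open>f\<close> is
  constant and the difference is identically zero, so the conclusion covers this case too.
\<close>

lemma pdiff_schur_class:
  assumes f: "f \<in> schur_class" and a: "a \<in> unit_disc"
  shows "(\<lambda>z. pdiff (f z) (f a)) holomorphic_on unit_disc"
    and "z \<in> unit_disc \<Longrightarrow> cmod (pdiff (f z) (f a)) < 1"
proof -
  have "(\<lambda>z. pdiff (f z) (f a)) holomorphic_on unit_disc \<and>
        (\<forall>z\<in>unit_disc. cmod (pdiff (f z) (f a)) < 1)"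
  proof (cases "\<exists>b\<in>unit_disc. cmod (f b) = 1")
    case True
    then have "pdiff (f z) (f a) = 0" if "z \<in> unit_disc" for z
      using schur_class_unimodular_constant[OF f] a that pdiff_self by metis
    then show ?thesis
      using holomorphic_cong[of unit_disc unit_disc "\<lambda>z. pdiff (f z) (f a)" "\<lambda>_. 0"] by auto
  next
    case False
    then have lt: "f z \<in> unit_disc" if "z \<in> unit_disc" for z
      using f that by (force simp: schur_class_def)
    have "(\<lambda>w. pdiff w (f a)) \<circ> f holomorphic_on unit_disc"
      using f lt a
      by (intro holomorphic_on_compose_gen[OF _ pdiff_holomorphic]) (auto simp: schur_class_def)
    then show ?thesis
      using lt a pdiff_in_disc by (simp add: o_def)
  qed
  then show "(\<lambda>z. pdiff (f z) (f a)) holomorphic_on unit_disc"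
    and "z \<in> unit_disc \<Longrightarrow> cmod (pdiff (f z) (f a)) < 1"
    by blast+
qed

text \<open>
  For a unimodular constant both sides are zero, the right one because of \<open>x / 0 = 0\<close>.
\<close>

lemma deriv_pdiff_schur_class:
  assumes k: "k \<in> schur_class" and a: "a \<in> unit_disc"
  shows "deriv (\<lambda>z. pdiff (k z) (k a)) a = deriv k a / of_real (1 - (cmod (k a))\<^sup>2)"
proof (cases "cmod (k a) = 1")
  case True
  have "eventually (\<lambda>z. z \<in> unit_disc) (nhds a)"
    using a by (intro eventually_nhds_in_open) auto
  then have "eventually (\<lambda>z. pdiff (k z) (k a) = 0) (nhds a)"
    by (rule eventually_mono)
       (use schur_class_unimodular_constant[OF k a _ True] pdiff_self in metis)
  then have "deriv (\<lambda>z. pdiff (k z) (k a)) a = deriv (\<lambda>_. 0) a"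
    by (intro deriv_cong_ev) auto
  then show ?thesis
    using True by simp
next
  case False
  then have "cmod (k a) < 1"
    using k a by (force simp: schur_class_def)
  moreover have "(k has_field_derivative deriv k a) (at a)"
    using k a by (intro holomorphic_derivI[of k unit_disc]) (auto simp: schur_class_def)
  ultimately show ?thesis
    using DERIV_chain2[OF pdiff_has_derivative_at_base] by (force intro!: DERIV_imp_deriv)
qed

section \<open>The Schur algorithm\<close>

lemma schur_step_nonzero: "z \<noteq> 0 \<Longrightarrow> schur_step k z = pdiff (k z) (k 0) / z"
  by (simp add: schur_step_def Let_def pdiff_def)

lemma schur_step_zero:
  assumes "k \<in> schur_class"
  shows "schur_step k 0 = deriv (\<lambda>z. pdiff (k z) (k 0)) 0"
proof -
  let ?q = "\<lambda>z. pdiff (k z) (k 0)"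
  have "(?q has_field_derivative deriv ?q 0) (at 0)"
    by (rule holomorphic_derivI[OF pdiff_schur_class(1)[OF assms]]) auto
  then have "((\<lambda>w. 1 / w * ?q w) \<longlongrightarrow> deriv ?q 0) (at 0)"
    by (simp add: DERIV_def pdiff_self)
  then have "Lim (at 0) (\<lambda>w. 1 / w * ?q w) = deriv ?q 0"
    by (intro tendsto_Lim) auto
  then show ?thesis
    by (simp add: schur_step_def Let_def pdiff_def)
qed

lemma schur_step_cong:
  assumes eq: "\<And>z. z \<in> unit_disc \<Longrightarrow> k z = l z" and z: "z \<in> unit_disc"
  shows "schur_step k z = schur_step l z"
proof -
  have "eventually (\<lambda>w. w \<in> unit_disc) (at (0::complex))"
    by (intro eventually_at_in_open') auto
  then have "eventually (\<lambda>w. 1 / w * ((k w - k 0) / (1 - cnj (k 0) * k w)) =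
                             1 / w * ((l w - l 0) / (1 - cnj (l 0) * l w))) (at 0)"
    by eventually_elim (simp add: eq)
  then have "Lim (at 0) (\<lambda>w. 1 / w * ((k w - k 0) / (1 - cnj (k 0) * k w))) =
             Lim (at 0) (\<lambda>w. 1 / w * ((l w - l 0) / (1 - cnj (l 0) * l w)))"
    unfolding Topological_Spaces.Lim_def by (simp only: tendsto_cong)
  then show ?thesis
    using eq[OF z] eq[of 0] by (simp add: schur_step_def)
qed

lemma funpow_schur_step_cong:
  assumes "\<And>z. z \<in> unit_disc \<Longrightarrow> k z = l z" and "z \<in> unit_disc"
  shows "(schur_step ^^ n) k z = (schur_step ^^ n) l z"
  using assms(2)
proof (induction n arbitrary: z)
  case (Suc n)
  then show ?case
    using schur_step_cong[of "(schur_step ^^ n) k" "(schur_step ^^ n) l"] by simp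
qed (use assms(1) in simp)

text \<open>
  Moving the value at \<open>0\<close> to the origin leaves the quotient that the Schur step is built from
  unchanged, since \<open>[w, 0] = w\<close>.
\<close>

lemma schur_step_normalise: "schur_step (\<lambda>w. pdiff (k w) (k 0)) = schur_step k"
  by (rule ext) (simp add: schur_step_def Let_def pdiff_def)

lemma schur_parameter_normalise:
  assumes "\<And>z. z \<in> unit_disc \<Longrightarrow> g z = pdiff (k z) (k 0)" and "n \<ge> 1"
  shows "schur_parameter g n = schur_parameter k n"
proof -
  obtain m where n: "n = Suc m"
    using \<open>n \<ge> 1\<close> by (cases n) auto
  have "(schur_step ^^ n) g 0 = (schur_step ^^ n) (\<lambda>w. pdiff (k w) (k 0)) 0"
    by (rule funpow_schur_step_cong) (use assms(1) in auto)
  then show ?thesis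
    by (simp add: schur_parameter_def n funpow_Suc_right schur_step_normalise del: funpow.simps)
qed

text \<open>
  The quotient \<open>[k(z), k(0)] / z\<close> is bounded by one because its numerator is a self-map of the disc
  that fixes the origin.
\<close>

lemma schur_step_schur_class:
  assumes k: "k \<in> schur_class"
  shows "schur_step k \<in> schur_class"
proof -
  let ?q = "\<lambda>z. pdiff (k z) (k 0)"
  have hol: "?q holomorphic_on unit_disc" and lt: "cmod z < 1 \<Longrightarrow> cmod (?q z) < 1" for z
    using pdiff_schur_class[OF k, of 0] by auto
  have q0: "?q 0 = 0"
    by (rule pdiff_self)
  obtain h where h: "h holomorphic_on unit_disc"
    "\<And>z. cmod z < 1 \<Longrightarrow> ?q z = z * h z" "deriv ?q 0 = h 0"
    using Schwarz3[OF hol q0] by blast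
  have eq: "h z = schur_step k z" if "z \<in> unit_disc" for z
    using that h by (cases "z = 0") (simp_all add: schur_step_zero[OF k] schur_step_nonzero)
  have "cmod (h z) \<le> 1" if "z \<in> unit_disc" for z
  proof (cases "z = 0")
    case True
    then show ?thesis
      using Schwarz_Lemma(2)[OF hol q0 lt, of 0] h(3) by simp
  next
    case False
    have "cmod z * cmod (h z) \<le> cmod z"
      using Schwarz_Lemma(1)[OF hol q0 lt, of z] h(2)[of z] that by (simp add: norm_mult)
    then show ?thesis
      using False by simp
  qed
  then have "h \<in> schur_class"
    using h(1) by (simp add: schur_class_def)
  then show ?thesis
    using eq by (rule schur_class_cong)
qed

section \<open>Hyperbolic difference quotients as Schur steps\<close>

lemma schur_class_disc_shift:
  assumes "h \<in> schur_class" "w \<in> unit_disc"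
  shows "(\<lambda>z. h (pdiff z w)) \<in> schur_class"
  by (rule schur_class_compose[OF assms(1) pdiff_holomorphic[OF assms(2)]])
     (use assms(2) pdiff_in_disc in blast)

text \<open>
  Away from \<open>0\<close> this is \<open>[\<phi>(z), z\<^sub>0] = z\<close>. At \<open>0\<close> the chain rule with
  \<open>\<phi>'(0) = 1 - |z\<^sub>0|\<^sup>2\<close> produces exactly the numerator in the definition of the value at the base
  point.
\<close>

lemma hyp_quot_disc_shift:
  assumes h: "h \<in> schur_class" and z0: "z0 \<in> unit_disc" and z: "z \<in> unit_disc"
  shows "hyp_quot z0 h (pdiff z (- z0)) = schur_step (\<lambda>w. h (pdiff w (- z0))) z"
proof -
  define k where "k = (\<lambda>w. h (pdiff w (- z0)))"
  have k: "k \<in> schur_class"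
    unfolding k_def using h z0 by (intro schur_class_disc_shift) auto
  have k0: "k 0 = h z0"
    by (simp add: k_def pdiff_zero_left)
  have inv: "pdiff (pdiff z (- z0)) z0 = z"
    using pdiff_inverse z z0 by simp
  have "hyp_quot z0 h (pdiff z (- z0)) = schur_step k z"
  proof (cases "z = 0")
    case True
    have "(h has_field_derivative deriv h z0) (at z0)"
      using h z0 by (intro holomorphic_derivI[of h unit_disc]) (auto simp: schur_class_def)
    then have "(k has_field_derivative deriv h z0 * of_real (1 - (cmod z0)\<^sup>2)) (at 0)"
      unfolding k_def
      by (intro DERIV_chain2[OF _ pdiff_has_derivative_at_zero]) (simp add: pdiff_zero_left)
    then have "deriv k 0 = deriv h z0 * of_real (1 - (cmod z0)\<^sup>2)"
      by (rule DERIV_imp_deriv)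
    then show ?thesis
      using True deriv_pdiff_schur_class[OF k, of 0]
      by (simp add: schur_step_zero[OF k] pdiff_zero_left hyp_quot_def k0 mult.commute)
  next
    case False
    then have "pdiff z (- z0) \<noteq> z0"
      using inv pdiff_self by metis
    then show ?thesis
      using False inv k0 by (simp add: hyp_quot_def schur_step_nonzero k_def)
  qed
  then show ?thesis
    by (simp add: k_def)
qed

text \<open>
  This is the Schwarz--Pick lemma; conjugation by the automorphism moves the base point to the
  origin, where it becomes the Schwarz lemma.
\<close>

lemma hyp_quot_schur_class:
  assumes h: "h \<in> schur_class" and z0: "z0 \<in> unit_disc"
  shows "hyp_quot z0 h \<in> schur_class"
proof (rule schur_class_cong)
  let ?s = "schur_step (\<lambda>w. h (pdiff w (- z0)))"
  show "(\<lambda>z. ?s (pdiff z z0)) \<in> schur_class"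
    using h z0 by (intro schur_class_disc_shift schur_step_schur_class) auto
  show "?s (pdiff z z0) = hyp_quot z0 h z" if "z \<in> unit_disc" for z
    using hyp_quot_disc_shift[OF h z0, of "pdiff z z0"] pdiff_in_disc pdiff_inverse(2) that z0
    by simp
qed

lemma hyp_divdiff_schur_class:
  assumes "f \<in> schur_class" "\<And>j. p j \<in> unit_disc"
  shows "hyp_divdiff f p n \<in> schur_class"
  by (induction n) (use assms hyp_quot_schur_class in auto)

lemma hyp_divdiff_disc_shift:
  assumes f: "f \<in> schur_class" and z0: "z0 \<in> unit_disc" and "z \<in> unit_disc"
  shows "hyp_divdiff f (\<lambda>_. z0) n (pdiff z (- z0)) =
         (schur_step ^^ n) (\<lambda>w. f (pdiff w (- z0))) z"
  using assms(3)
proof (induction n arbitrary: z)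
  case (Suc n)
  let ?F = "hyp_divdiff f (\<lambda>_. z0) n"
  have "hyp_quot z0 ?F (pdiff z (- z0)) = schur_step (\<lambda>w. ?F (pdiff w (- z0))) z"
    using hyp_divdiff_schur_class f z0 Suc.prems by (intro hyp_quot_disc_shift) auto
  also have "\<dots> = schur_step ((schur_step ^^ n) (\<lambda>w. f (pdiff w (- z0)))) z"
    by (rule schur_step_cong) (use Suc in auto)
  finally show ?case
    by simp
qed simp

section \<open>Peschl's invariant derivatives\<close>

lemma power_series_coeff_unique:
  fixes D :: "nat \<Rightarrow> complex"
  assumes "\<And>z. z \<in> unit_disc \<Longrightarrow> (\<lambda>k. D k / fact k * z ^ k) sums g z"
  shows "D n = (deriv ^^ n) g 0"
proof -
  have "eventually (\<lambda>z. z \<in> unit_disc) (nhds (0::complex))"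
    by (intro eventually_nhds_in_open) auto
  then have "g has_fps_expansion Abs_fps (\<lambda>k. D k / fact k)"
    by (intro has_fps_expansionI, elim eventually_mono) (use assms in simp)
  then show ?thesis
    using fps_nth_fps_expansion[of g "Abs_fps (\<lambda>k. D k / fact k)" n] by simp
qed

text \<open>
  Peschl's expansion begins at index one, which is consistent with Taylor's because the expanded
  function vanishes at the origin.
\<close>

lemma peschl_deriv_eq_higher_deriv:
  assumes hol: "g holomorphic_on unit_disc"
    and g: "\<And>z. z \<in> unit_disc \<Longrightarrow> g z = pdiff (f (pdiff z (- z0))) (f z0)"
  shows "peschl_deriv n f z0 = (deriv ^^ n) g 0"
proof -
  let ?P = "\<lambda>D :: nat \<Rightarrow> complex. D 0 = 0 \<and>
        (\<forall>z\<in>unit_disc. (\<lambda>k. D (Suc k) / fact (Suc k) * z ^ Suc k) sums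
             pdiff (f (pdiff z (- z0))) (f z0))"
  have P_iff: "?P D \<longleftrightarrow> D 0 = 0 \<and> (\<forall>z\<in>unit_disc. (\<lambda>k. D k / fact k * z ^ k) sums g z)" for D
    using sums_Suc_iff[of "\<lambda>k. D k / fact k * _ ^ k"] by (auto simp: g simp del: fact_Suc)
  have "g 0 = 0"
    by (simp add: g pdiff_zero_left pdiff_self)
  then have "(\<lambda>n. (deriv ^^ n) g 0) 0 = 0 \<and>
    (\<forall>z\<in>unit_disc. (\<lambda>k. (\<lambda>n. (deriv ^^ n) g 0) k / fact k * z ^ k) sums g z)"
    using holomorphic_power_series[OF hol] by simp
  then have "?P (\<lambda>n. (deriv ^^ n) g 0)"
    by (rule iffD2[OF P_iff])
  moreover have "D = (\<lambda>n. (deriv ^^ n) g 0)" if "?P D" for D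
    using iffD1[OF P_iff that] power_series_coeff_unique[of D g] by blast
  ultimately have "(THE D. ?P D) = (\<lambda>n. (deriv ^^ n) g 0)"
    by (rule the_equality)
  then show ?thesis
    by (simp only: peschl_deriv_def)
qed

section \<open>Peschl's derivatives and Schur parameters at a point\<close>

theorem proposition3p3:
  fixes f g :: "complex \<Rightarrow> complex" and z0 :: complex
  assumes "f \<in> schur_class" and "z0 \<in> unit_disc"
    and "\<And>z. z \<in> unit_disc \<Longrightarrow> g z = pdiff (f (pdiff z (- z0))) (f z0)"
  shows "g \<in> schur_class \<and>
    (\<forall>n\<ge>1. (deriv ^^ n) g 0 = peschl_deriv n f z0 \<and>
            hyp_divdiff f (\<lambda>_. z0) n z0 = schur_parameter g n)"
proof -
  define k where "k = (\<lambda>w. f (pdiff w (- z0)))"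
  have k: "k \<in> schur_class"
    unfolding k_def using assms(1,2) by (intro schur_class_disc_shift) auto
  have g: "g z = pdiff (k z) (k 0)" if "z \<in> unit_disc" for z
    using assms(3)[OF that] by (simp add: k_def pdiff_zero_left)
  have "(\<lambda>z. pdiff (k z) (k 0)) \<in> schur_class"
    using pdiff_schur_class[OF k, of 0] by (auto simp: schur_class_def less_imp_le)
  then have gS: "g \<in> schur_class"
    by (rule schur_class_cong) (use g in simp)
  have "hyp_divdiff f (\<lambda>_. z0) n z0 = schur_parameter g n" if "n \<ge> 1" for n
  proof -
    have "hyp_divdiff f (\<lambda>_. z0) n z0 = schur_parameter k n"
      using hyp_divdiff_disc_shift[OF assms(1,2), of 0 n]
      by (simp add: pdiff_zero_left schur_parameter_def k_def)
    then show ?thesis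
      using schur_parameter_normalise[of g k n] g that by simp
  qed
  moreover have "(deriv ^^ n) g 0 = peschl_deriv n f z0" for n
    using peschl_deriv_eq_higher_deriv[of g f z0 n] assms(3) gS by (simp add: schur_class_def)
  ultimately show ?thesis
    using gS by blast
qed

end
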